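(* Let $d\ge1$ and let $H$ be a hypergraph of $d$-intervals. Then $\tau^*(H)\le\left(4d-6+\frac{3}{d}\right)\nu(H)$.
   Context: A $d$-interval is a union of at most $d$ pairwise disjoint closed intervals of the real line $\mathbb{R}$. A hypergraph of $d$-intervals is a finite family $H$ of $d$-intervals, regarded as a hypergraph whose vertices are the points of $\mathbb{R}$ and whose edges are the members of $H$. A matching is a set of pairwise disjoint edges and $\nu(H)$ is its maximum size. A fractional cover is a finitely supported $g:\mathbb{R}\to\mathbb{R}_{\ge0}$ with $\sum_{v\in h}g(v)\ge1$ for every $h\in H$; $\tau^*(H)$ is the infimum of $\sum_v g(v)$ over fractional covers. *)

theory Defs
  imports Complex_Main
begin

definition d_interval :: "nat \<Rightarrow> real set \<Rightarrow> bool" where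
  "d_interval d S \<longleftrightarrow>
     (\<exists>k (a :: nat \<Rightarrow> real) b. 1 \<le> k \<and> k \<le> d \<and> (\<forall>i<k. a i \<le> b i) \<and>
        (\<forall>i<k. \<forall>j<k. i \<noteq> j \<longrightarrow> {a i..b i} \<inter> {a j..b j} = {}) \<and>
        S = (\<Union>i<k. {a i..b i}))"

definition matching :: "real set set \<Rightarrow> real set set \<Rightarrow> bool" where
  "matching H M \<longleftrightarrow> M \<subseteq> H \<and> (\<forall>e\<in>M. \<forall>f\<in>M. e \<noteq> f \<longrightarrow> e \<inter> f = {})"

definition matching_number :: "real set set \<Rightarrow> nat" where
  "matching_number H = Max {card M | M. matching H M}"

definition supp :: "(real \<Rightarrow> real) \<Rightarrow> real set" where
  "supp g = {v. g v \<noteq> 0}"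

definition fractional_cover :: "real set set \<Rightarrow> (real \<Rightarrow> real) \<Rightarrow> bool" where
  "fractional_cover H g \<longleftrightarrow> finite (supp g) \<and> (\<forall>v. g v \<ge> 0) \<and>
     (\<forall>h\<in>H. (\<Sum>v\<in>supp g \<inter> h. g v) \<ge> 1)"

definition frac_cover_number :: "real set set \<Rightarrow> real" where
  "frac_cover_number H = Inf {(\<Sum>v\<in>supp g. g v) | g. fractional_cover H g}"

end

theory Submission
  imports Defs "HOL-Analysis.Analysis"
begin

text \<open>
  For \<open>d \<ge> 3\<close> the bound follows from \<open>\<tau>\<^sup>* \<le> 2 d \<nu>\<close> (Alon): if two \<open>d\<close>-intervals meet, one contains a
  left endpoint of the other, so under edge weights with load at most \<open>L\<close> at every left endpoint
  some edge meets edges of total weight at most \<open>2 d L\<close>; choosing such edges greedily gives a matching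
  of size at least the total weight divided by \<open>2 d L\<close>, and LP duality turns this into a fractional cover.

  For \<open>d \<le> 2\<close> an argument of Tardos and Kaiser gives integral covers of size \<open>3 \<nu>\<close> (\<open>\<nu>\<close> if \<open>d = 1\<close>).
  Points of the simplex with \<open>n\<close> vertices encode \<open>n - 1\<close> cut points on the line. An edge that avoids the cuts
  joins the two gaps containing its components, with a weight depending continuously on the cuts.
  A gap of length zero receives no weight, so Brouwer's theorem yields cuts for which all gaps receive
  the same weight. If that weight is \<open>0\<close>, the cuts pierce every edge. Otherwise the
  gaps form a graph with a perfect fractional matching, which has a matching with at least \<open>n / 3\<close> edges, and
  the corresponding members of \<open>H\<close> are disjoint.
\<close>

section \<open>Brouwer's theorem on cubes of variable dimension\<close>

text \<open>The library version has the dimension fixed by a type; here \<open>n\<close> depends on the matching number.\<close>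

lemma tendsto_fun_iff:
  fixes f :: "'a \<Rightarrow> 'i \<Rightarrow> 'b::topological_space"
  shows "(f \<longlongrightarrow> l) F \<longleftrightarrow> (\<forall>i. ((\<lambda>x. f x i) \<longlongrightarrow> l i) F)"
  using limitin_componentwise[of "\<lambda>_. euclidean" UNIV f l F]
  by (simp add: euclidean_product_topology)

lemma compact_fun_cube:
  "compact {x :: 'i \<Rightarrow> real. \<forall>i. 0 \<le> x i \<and> x i \<le> 1}"
proof -
  have "{x :: 'i \<Rightarrow> real. \<forall>i. 0 \<le> x i \<and> x i \<le> 1} = PiE UNIV (\<lambda>_. {0..1})"
    by (auto simp: PiE_iff)
  moreover have "compactin (product_topology (\<lambda>_. euclidean) UNIV) (PiE (UNIV :: 'i set) (\<lambda>_. {0..1::real}))"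
    by (simp add: compactin_PiE)
  ultimately show ?thesis
    by (simp add: euclidean_product_topology)
qed

text \<open>Kuhn's lemma gives, in every grid of mesh \<open>1 / Suc p\<close>, a cell that carries
  both labels in each coordinate below \<open>n\<close>. By compactness these cells accumulate at a
  point, where continuity makes both inequalities hold.\<close>

lemma brouwer_nat_cube:
  fixes f :: "(nat \<Rightarrow> real) \<Rightarrow> nat \<Rightarrow> real"
  defines "K \<equiv> {x. \<forall>i. 0 \<le> x i \<and> x i \<le> 1}"
  assumes cont: "\<And>i. i < n \<Longrightarrow> continuous_on K (\<lambda>x. f x i)"
    and range: "\<And>x i. x \<in> K \<Longrightarrow> i < n \<Longrightarrow> 0 \<le> f x i \<and> f x i \<le> 1"
  shows "\<exists>x\<in>K. \<forall>i<n. f x i = x i"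
proof -
  \<comment> \<open>Coordinates from \<open>n\<close> on are set to 0, so that grid points lie in
    \<open>K\<close>.\<close>
  define G where "G p q = (\<lambda>i. if i < n then real (q i) / real (Suc p) else 0)" for p and q :: "nat \<Rightarrow> nat"
  \<comment> \<open>Label 0 means that \<open>f\<close> does not decrease the coordinate. Excluding
    \<open>x i = 1\<close> gives the upper face the label 1 that Kuhn's lemma demands; since
    \<open>f x i \<le> 1\<close> there, label 1 still means that \<open>f\<close> does not increase
    the coordinate.\<close>
  define lab where "lab x i = (if x i \<le> f x i \<and> x i \<noteq> 1 then 0 else 1 :: nat)" for x i
  have G_in: "G p q \<in> K" if "\<forall>i<n. q i \<le> Suc p" for p q
    using that by (auto simp: G_def K_def divide_le_eq)
  have "\<forall>p. \<exists>q. (\<forall>i<n. q i < Suc p) \<and> (\<forall>i<n. \<exists>r s. (\<forall>j<n. q j \<le> r j \<and> r j \<le> q j + 1) \<and>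
      (\<forall>j<n. q j \<le> s j \<and> s j \<le> q j + 1) \<and> lab (G p r) i \<noteq> lab (G p s) i)"
  proof
    fix p
    have "\<forall>x. (\<forall>i<n. x i \<le> Suc p) \<longrightarrow> (\<forall>i<n. lab (G p x) i = 0 \<or> lab (G p x) i = 1)"
      by (auto simp: lab_def)
    moreover have "\<forall>x. (\<forall>i<n. x i \<le> Suc p) \<longrightarrow> (\<forall>i<n. x i = 0 \<longrightarrow> lab (G p x) i = 0)"
    proof (intro allI impI)
      fix x :: "nat \<Rightarrow> nat" and i assume x: "\<forall>i<n. x i \<le> Suc p" "i < n" "x i = 0"
      then show "lab (G p x) i = 0"
        using range[OF G_in[OF x(1)] x(2)] by (auto simp: lab_def G_def)
    qed
    moreover have "\<forall>x. (\<forall>i<n. x i \<le> Suc p) \<longrightarrow> (\<forall>i<n. x i = Suc p \<longrightarrow> lab (G p x) i = 1)"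
      by (auto simp: lab_def G_def simp del: of_nat_Suc)
    ultimately show "\<exists>q. (\<forall>i<n. q i < Suc p) \<and> (\<forall>i<n. \<exists>r s. (\<forall>j<n. q j \<le> r j \<and> r j \<le> q j + 1) \<and>
      (\<forall>j<n. q j \<le> s j \<and> s j \<le> q j + 1) \<and> lab (G p r) i \<noteq> lab (G p s) i)"
      by (rule kuhn_lemma[of "Suc p" n "\<lambda>x. lab (G p x)", rotated]) auto
  qed
  from choice[OF this] obtain q where
    q0: "\<forall>p. (\<forall>i<n. q p i < Suc p) \<and> (\<forall>i<n. \<exists>r s. (\<forall>j<n. q p j \<le> r j \<and> r j \<le> q p j + 1) \<and>
      (\<forall>j<n. q p j \<le> s j \<and> s j \<le> q p j + 1) \<and> lab (G p r) i \<noteq> lab (G p s) i)" ..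
  have q: "q p i < Suc p" if "i < n" for p i using q0 that by blast
  have ex': "\<exists>r s. (\<forall>j<n. q p j \<le> r j \<and> r j \<le> q p j + 1) \<and> (\<forall>j<n. q p j \<le> s j \<and> s j \<le> q p j + 1) \<and>
      G p r i \<le> f (G p r) i \<and> f (G p s) i \<le> G p s i" if i: "i < n" for p i
  proof -
    obtain r s where rs: "\<forall>j<n. q p j \<le> r j \<and> r j \<le> q p j + 1"
      "\<forall>j<n. q p j \<le> s j \<and> s j \<le> q p j + 1" "lab (G p r) i \<noteq> lab (G p s) i"
      using q0[rule_format, of p] i by blast
    have "r j \<le> Suc p" "s j \<le> Suc p" if "j < n" for j
      using rs(1)[rule_format, OF that] rs(2)[rule_format, OF that] q[OF that, of p] by linarith+
    then have "f (G p r) i \<le> 1" "f (G p s) i \<le> 1"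
      using range G_in i by blast+
    then have "(G p r i \<le> f (G p r) i \<and> f (G p s) i \<le> G p s i) \<or>
        (G p s i \<le> f (G p s) i \<and> f (G p r) i \<le> G p r i)"
      using rs(3) by (auto simp: lab_def split: if_splits)
    then show ?thesis using rs(1,2) by blast
  qed
  have "seq_compact K"
    unfolding K_def compact_eq_seq_compact_metric[symmetric] by (rule compact_fun_cube)
  moreover have "\<forall>p. G p (q p) \<in> K"
    by (intro allI G_in) (auto intro: less_imp_le q)
  ultimately obtain z k where z: "z \<in> K" and k: "strict_mono k"
    and lim: "((\<lambda>p. G p (q p)) \<circ> k) \<longlonglongrightarrow> z"
    by (rule seq_compactE)
  \<comment> \<open>All corners of the chosen cells share the limit \<open>z\<close>, because the
    cells shrink.\<close>
  have near: "(\<lambda>p. G (k p) (t (k p))) \<longlonglongrightarrow> z"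
    if t: "\<And>p j. j < n \<Longrightarrow> q p j \<le> t p j \<and> t p j \<le> q p j + 1" for t
    unfolding tendsto_fun_iff
  proof
    fix j
    have lim_j: "(\<lambda>p. G (k p) (q (k p)) j) \<longlonglongrightarrow> z j"
      using lim unfolding tendsto_fun_iff by (simp add: o_def)
    have "(\<lambda>p. 1 / real (Suc p)) \<longlonglongrightarrow> 0"
      using LIMSEQ_inverse_real_of_nat by (simp add: inverse_eq_divide)
    from LIMSEQ_subseq_LIMSEQ[OF this k] 
    have lim0: "(\<lambda>p. 1 / real (Suc (k p))) \<longlonglongrightarrow> 0" by (simp only: o_def)
    have "norm (G (k p) (t (k p)) j - G (k p) (q (k p)) j) \<le> 1 / real (Suc (k p))" for p
    proof (cases "j < n")
      case True
      have "\<bar>real (t (k p) j) - real (q (k p) j)\<bar> \<le> 1" using t[OF True, of "k p"] by linarith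
      then have "\<bar>real (t (k p) j) - real (q (k p) j)\<bar> / real (Suc (k p)) \<le> 1 / real (Suc (k p))"
        by (rule divide_right_mono) simp
      then show ?thesis using True by (simp only: G_def if_True diff_divide_distrib[symmetric] real_norm_def abs_divide abs_of_nat)
    qed (simp add: G_def)
    then have "(\<lambda>p. G (k p) (t (k p)) j - G (k p) (q (k p)) j) \<longlonglongrightarrow> 0"
      by (intro Lim_null_comparison[OF always_eventually lim0] allI)
    from tendsto_add[OF this lim_j] show "(\<lambda>p. G (k p) (t (k p)) j) \<longlonglongrightarrow> z j"
      by simp
  qed
  have in_K: "G p (t p) \<in> K" if t: "\<And>p j. j < n \<Longrightarrow> q p j \<le> t p j \<and> t p j \<le> q p j + 1" for t p
  proof (intro G_in allI impI)
    fix j assume "j < n"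
    then show "t p j \<le> Suc p" using t[of j p] q[of j p] by linarith
  qed
  have "f z i = z i" if i: "i < n" for i
  proof -
    have lim_f: "(\<lambda>p. f (G (k p) (t (k p))) i) \<longlonglongrightarrow> f z i"
      and lim_G: "(\<lambda>p. G (k p) (t (k p)) i) \<longlonglongrightarrow> z i"
      if t: "\<And>p j. j < n \<Longrightarrow> q p j \<le> t p j \<and> t p j \<le> q p j + 1" for t
    proof -
      show "(\<lambda>p. f (G (k p) (t (k p))) i) \<longlonglongrightarrow> f z i"
      proof (rule continuous_on_tendsto_compose[OF cont[OF i] near z])
        show "\<forall>\<^sub>F p in sequentially. G (k p) (t (k p)) \<in> K"
          using in_K[of t] t by (intro always_eventually) blast
      qed (use t in blast)
      show "(\<lambda>p. G (k p) (t (k p)) i) \<longlonglongrightarrow> z i"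
        using near[OF t] unfolding tendsto_fun_iff by blast
    qed
    have "\<forall>p. \<exists>rs. (\<forall>j<n. q p j \<le> fst rs j \<and> fst rs j \<le> q p j + 1) \<and>
        (\<forall>j<n. q p j \<le> snd rs j \<and> snd rs j \<le> q p j + 1) \<and>
        G p (fst rs) i \<le> f (G p (fst rs)) i \<and> f (G p (snd rs)) i \<le> G p (snd rs) i"
      using ex'[OF i] by simp
    from choice[OF this] obtain rs where
      rs: "\<forall>p. (\<forall>j<n. q p j \<le> fst (rs p) j \<and> fst (rs p) j \<le> q p j + 1) \<and>
        (\<forall>j<n. q p j \<le> snd (rs p) j \<and> snd (rs p) j \<le> q p j + 1) \<and>
        G p (fst (rs p)) i \<le> f (G p (fst (rs p))) i \<and> f (G p (snd (rs p))) i \<le> G p (snd (rs p)) i" ..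
    define r where "r p = fst (rs p)" for p
    define s where "s p = snd (rs p)" for p
    have r: "q p j \<le> r p j \<and> r p j \<le> q p j + 1"
      and s: "q p j \<le> s p j \<and> s p j \<le> q p j + 1" if "j < n" for p j
      using rs[rule_format, of p] that unfolding r_def s_def by blast+
    have fr: "G p (r p) i \<le> f (G p (r p)) i"
      and fs: "f (G p (s p)) i \<le> G p (s p) i" for p
      using rs[rule_format, of p] unfolding r_def s_def by blast+
    have "f z i \<le> z i"
      by (rule LIMSEQ_le[OF lim_f[OF s] lim_G[OF s]]) (use fs in auto)
    moreover have "z i \<le> f z i"
      by (rule LIMSEQ_le[OF lim_G[OF r] lim_f[OF r]]) (use fr in auto)
    ultimately show ?thesis by simp
  qed
  then show ?thesis using z by blast
qed

section \<open>Cut points and gaps\<close>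

text \<open>The map is the one of Nash's existence proof: coordinates are raised by their deficit
  \<open>m\<close> below the mean and then normalised. At a fixed point with positive total deficit,
  either every \<open>u x j\<close> is below the mean, or some \<open>x j = 0\<close>, where
  \<open>face\<close> forces the mean down to 0 and all deficits vanish. Both are absurd.\<close>

lemma equalize_on_simplex:
  fixes u :: "(nat \<Rightarrow> real) \<Rightarrow> nat \<Rightarrow> real" and n :: nat
  defines "\<Delta> \<equiv> {x. (\<forall>i. 0 \<le> x i \<and> x i \<le> 1) \<and> (\<Sum>i<n. x i) = 1}"
  assumes "0 < n" and cont: "\<And>j. j < n \<Longrightarrow> continuous_on \<Delta> (\<lambda>x. u x j)"
    and face: "\<And>x j. x \<in> \<Delta> \<Longrightarrow> j < n \<Longrightarrow> x j = 0 \<Longrightarrow> u x j = 0"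
    and nonneg: "\<And>x j. x \<in> \<Delta> \<Longrightarrow> j < n \<Longrightarrow> 0 \<le> u x j"
  shows "\<exists>x\<in>\<Delta>. \<forall>j<n. u x j = (\<Sum>i<n. u x i) / real n"
proof -
  define K where "K = {x :: nat \<Rightarrow> real. \<forall>i. 0 \<le> x i \<and> x i \<le> 1}"
  \<comment> \<open>Truncated partial sums, forced to 1 at \<open>n\<close>: their differences
    \<open>\<rho>\<close> map the whole cube continuously into the simplex and keep the first
    \<open>n\<close> coordinates of points of the simplex.\<close>
  define P where "P z k = (if k < n then min 1 (\<Sum>i<k. z i) else 1)" for z :: "nat \<Rightarrow> real" and k
  define \<rho> where "\<rho> z = (\<lambda>j. if j < n then P z (Suc j) - P z j else 0)" for z
  define m where "m x j = max 0 ((\<Sum>i<n. u x i) / real n - u x j)" for x j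
  define f where "f z j = (\<rho> z j + m (\<rho> z) j) / (1 + (\<Sum>i<n. m (\<rho> z) i))" for z j
  have coord: "continuous_on S (\<lambda>x. x i)" for S and i :: nat
    by (rule continuous_on_subset[OF continuous_on_product_coordinates subset_UNIV])
  have cont_\<rho>: "continuous_on K \<rho>"
  proof (rule continuous_on_coordinatewise_then_product)
    have cont_P: "continuous_on K (\<lambda>z. P z k)" for k
      unfolding P_def by (cases "k < n") (auto intro!: continuous_intros coord)
    show "continuous_on K (\<lambda>z. \<rho> z j)" for j
      unfolding \<rho>_def by (cases "j < n") (auto intro!: continuous_intros cont_P)
  qed
  have sum_\<rho>: "(\<Sum>i<n. \<rho> z i) = 1" for z
  proof -
    have "(\<Sum>i<n. \<rho> z i) = (\<Sum>i<n. P z (Suc i) - P z i)" by (simp add: \<rho>_def)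
    also have "\<dots> = P z n - P z 0" by (rule sum_lessThan_telescope)
    finally show ?thesis using \<open>0 < n\<close> by (simp add: P_def)
  qed
  have \<rho>_in: "\<rho> z \<in> \<Delta>" if z: "z \<in> K" for z
  proof -
    have P: "0 \<le> P z k" "P z k \<le> 1" "P z k \<le> P z (Suc k)" for k
    proof -
      have "0 \<le> (\<Sum>i<k. z i)" "0 \<le> z k" using z by (auto simp: K_def intro: sum_nonneg)
      then show "0 \<le> P z k" "P z k \<le> 1" "P z k \<le> P z (Suc k)" by (auto simp: P_def)
    qed
    have "0 \<le> \<rho> z i \<and> \<rho> z i \<le> 1" for i
      using P(1)[of i] P(2)[of "Suc i"] P(3)[of i] by (simp add: \<rho>_def)
    then show ?thesis using sum_\<rho> by (auto simp: \<Delta>_def)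
  qed
  have m_nonneg: "0 \<le> m x j" for x j by (simp add: m_def)
  have "\<exists>z\<in>K. \<forall>j<n. f z j = z j"
    unfolding K_def
  proof (rule brouwer_nat_cube, fold K_def)
    have cont_u: "continuous_on K (\<lambda>z. u (\<rho> z) j)" if "j < n" for j
      by (rule continuous_on_compose2[OF cont[OF that] cont_\<rho>]) (use \<rho>_in in auto)
    have cont_m: "continuous_on K (\<lambda>z. m (\<rho> z) j)" if "j < n" for j
      unfolding m_def using \<open>0 < n\<close> that by (auto intro!: continuous_intros cont_u)
    have "1 + (\<Sum>i<n. m (\<rho> z) i) \<noteq> 0" for z
      using sum_nonneg[of "{..<n}" "m (\<rho> z)"] m_nonneg by (smt (verit))
    then show "continuous_on K (\<lambda>z. f z j)" if "j < n" for j
      unfolding f_def using that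
      by (auto intro!: continuous_intros cont_m continuous_on_product_then_coordinatewise[OF cont_\<rho>])
    show "0 \<le> f z j \<and> f z j \<le> 1" if z: "z \<in> K" and j: "j < n" for z j
    proof -
      have "0 \<le> \<rho> z j" "\<rho> z j \<le> 1" using \<rho>_in[OF z] by (auto simp: \<Delta>_def)
      moreover have "m (\<rho> z) j \<le> (\<Sum>i<n. m (\<rho> z) i)"
        using j m_nonneg by (intro member_le_sum) auto
      ultimately show ?thesis using m_nonneg[of "\<rho> z" j] by (simp add: f_def)
    qed
  qed
  then obtain z where z: "z \<in> K" and fix_z: "\<And>j. j < n \<Longrightarrow> f z j = z j" by blast
  define x where "x = \<rho> z"
  define S where "S = (\<Sum>i<n. m x i)"
  have S: "0 \<le> S" using m_nonneg by (simp add: S_def sum_nonneg)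
  have x: "x \<in> \<Delta>" using \<rho>_in z by (simp add: x_def)
  \<comment> \<open>A fixed point has coordinate sum 1, so the truncation in \<open>P\<close> has no
    effect at \<open>z\<close>, and \<open>x\<close> agrees with \<open>z\<close> below
    \<open>n\<close>.\<close>
  have "(\<Sum>j<n. z j) = (\<Sum>j<n. (x j + m x j) / (1 + S))"
    using fix_z by (intro sum.cong) (auto simp: f_def x_def S_def)
  also have "\<dots> = ((\<Sum>j<n. x j) + S) / (1 + S)"
    by (simp add: sum_divide_distrib[symmetric] sum.distrib S_def)
  also have "\<dots> = 1" using S sum_\<rho> by (simp add: x_def)
  finally have sum_z: "(\<Sum>j<n. z j) = 1" .
  have P_z: "P z k = (\<Sum>i<k. z i)" if "k \<le> n" for k
  proof -
    have "(\<Sum>i<k. z i) \<le> (\<Sum>j<n. z j)"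
      using that z by (intro sum_mono2) (auto simp: K_def)
    then show ?thesis using sum_z that by (cases "k = n") (auto simp: P_def)
  qed
  have key: "x j * S = m x j" if j: "j < n" for j
  proof -
    have "x j = z j" using j P_z[of j] P_z[of "Suc j"] by (simp add: x_def \<rho>_def)
    then show ?thesis using fix_z[OF j] S by (simp add: f_def x_def[symmetric] S_def[symmetric] field_simps)
  qed
  have "S = 0"
  proof (rule ccontr)
    assume "S \<noteq> 0"
    have pos: "0 < m x j" if j: "j < n" for j
    proof (rule ccontr)
      assume "\<not> 0 < m x j"
      then have "m x j = 0" using m_nonneg[of x j] by simp
      then have "x j = 0" using key[OF j] \<open>S \<noteq> 0\<close> by simp
      then have "u x j = 0" using face x j by blast
      then have "(\<Sum>i<n. u x i) / real n \<le> 0"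
        using \<open>m x j = 0\<close> unfolding m_def by linarith
      then have "m x i = 0" if "i < n" for i
        using nonneg[OF x that] by (simp add: m_def)
      then show False using \<open>S \<noteq> 0\<close> by (simp add: S_def)
    qed
    have "u x j < (\<Sum>i<n. u x i) / real n" if "j < n" for j
      using pos[OF that] unfolding m_def by linarith
    then have "(\<Sum>j<n. u x j) < (\<Sum>j<n. (\<Sum>i<n. u x i) / real n)"
      using \<open>0 < n\<close> by (intro sum_strict_mono) auto
    then show False using \<open>0 < n\<close> by simp
  qed
  have le: "(\<Sum>i<n. u x i) / real n \<le> u x j" if "j < n" for j
  proof -
    have "m x j = 0" using \<open>S = 0\<close> that m_nonneg by (simp add: S_def sum_nonneg_eq_0_iff)
    then show ?thesis unfolding m_def by linarith
  qed
  have "u x j = (\<Sum>i<n. u x i) / real n" if j: "j < n" for j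
  proof (rule ccontr)
    assume "u x j \<noteq> (\<Sum>i<n. u x i) / real n"
    then have "(\<Sum>i<n. u x i) / real n < u x j" using le[OF j] by linarith
    then have "(\<Sum>j<n. (\<Sum>i<n. u x i) / real n) < (\<Sum>j<n. u x j)"
      using le j by (intro sum_strict_mono_ex1) blast+
    then show False using \<open>0 < n\<close> by simp
  qed
  then show ?thesis using x by blast
qed

text \<open>The matrix \<open>A\<close> records the edges by the pair of gaps that hold their two
  components; loops \<open>A i i\<close> are allowed. The two components need not be disjoint, so a
  single interval can be given as both.\<close>

lemma piercing_or_balanced_gaps:
  fixes H :: "real set set" and a b a' b' :: "real set \<Rightarrow> real"
  assumes "finite H" "0 < n"
    and H: "\<And>h. h \<in> H \<Longrightarrow> a h \<le> b h \<and> a' h \<le> b' h \<and> h = {a h..b h} \<union> {a' h..b' h}"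
  obtains (pierce) C where "finite C" "card C < n" "\<And>h. h \<in> H \<Longrightarrow> C \<inter> h \<noteq> {}"
  | (gaps) D :: "nat \<Rightarrow> real set" and A :: "nat \<Rightarrow> nat \<Rightarrow> real" and c
    where "disjoint_family_on D {..<n}" "\<And>i j. A i j = A j i" "\<And>i j. 0 \<le> A i j"
      "\<And>i. i < n \<Longrightarrow> (\<Sum>j<n. A i j) = c" "0 < c"
      "\<And>i j. 0 < A i j \<Longrightarrow> \<exists>h\<in>H. ({a h..b h} \<subseteq> D i \<and> {a' h..b' h} \<subseteq> D j) \<or>
        ({a h..b h} \<subseteq> D j \<and> {a' h..b' h} \<subseteq> D i)"
proof -
  define \<Delta> where "\<Delta> = {x :: nat \<Rightarrow> real. (\<forall>i. 0 \<le> x i \<and> x i \<le> 1) \<and> (\<Sum>i<n. x i) = 1}"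
  \<comment> \<open>The bounds are strict so that a component left or right of all cuts lies in an
    open outer gap.\<close>
  obtain lo hi :: real where lohi: "\<And>h. h \<in> H \<Longrightarrow> lo < a h \<and> lo < a' h \<and> b h < hi \<and> b' h < hi"
  proof -
    let ?S = "insert 0 (a ` H \<union> a' ` H)" and ?T = "insert 0 (b ` H \<union> b' ` H)"
    have fin: "finite ?S" "finite ?T" using \<open>finite H\<close> by auto
    have "Min ?S - 1 < a h \<and> Min ?S - 1 < a' h \<and> b h < Max ?T + 1 \<and> b' h < Max ?T + 1" if "h \<in> H" for h
    proof -
      have "Min ?S \<le> a h" "Min ?S \<le> a' h" "b h \<le> Max ?T" "b' h \<le> Max ?T"
        using that fin by (auto intro!: Min_le Max_ge)
      then show ?thesis by linarith
    qed
    then show thesis using that by blast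
  qed
  define q where "q x k = lo + (hi - lo) * (\<Sum>i<k. x i)" for x :: "nat \<Rightarrow> real" and k
  \<comment> \<open>For \<open>l \<le> r\<close> this is the distance from \<open>{l..r}\<close> to
    the nearer end of gap \<open>j\<close> if it lies inside, and 0 otherwise: continuous in the
    cuts and positive exactly on containment in the open gap.\<close>
  define \<psi> where "\<psi> l r x j = max 0 (min (l - q x j) (q x (Suc j) - r))" for l r x j
  define W where "W x i j = (\<Sum>h\<in>H. \<psi> (a h) (b h) x i * \<psi> (a' h) (b' h) x j)" for x i j
  define A where "A x i j = W x i j + W x j i" for x i j
  have \<psi>_nonneg: "0 \<le> \<psi> l r x j" for l r x j by (simp add: \<psi>_def)
  have W_nonneg: "0 \<le> W x i j" for x i j by (simp add: W_def sum_nonneg \<psi>_nonneg)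
  have coord: "continuous_on S (\<lambda>x. x i)" for S and i :: nat
    by (rule continuous_on_subset[OF continuous_on_product_coordinates subset_UNIV])
  have "\<exists>x\<in>\<Delta>. \<forall>j<n. (\<Sum>i<n. A x j i) = (\<Sum>k<n. \<Sum>i<n. A x k i) / real n"
    unfolding \<Delta>_def
  proof (rule equalize_on_simplex[OF \<open>0 < n\<close>], fold \<Delta>_def)
    show "continuous_on \<Delta> (\<lambda>x. \<Sum>i<n. A x j i)" for j
      unfolding A_def W_def \<psi>_def q_def by (intro continuous_intros coord)
    show "0 \<le> (\<Sum>i<n. A x j i)" for x j by (simp add: A_def W_nonneg sum_nonneg)
    fix x :: "nat \<Rightarrow> real" and j assume "x j = 0"
    \<comment> \<open>The ends of the gap coincide, so one of the two distances is at most
      0.\<close>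
    then have "\<psi> l r x j = 0" if "l \<le> r" for l r using that by (simp add: \<psi>_def q_def)
    then have "W x i j = 0" "W x j i = 0" for i using H by (auto simp: W_def intro!: sum.neutral)
    then show "(\<Sum>i<n. A x j i) = 0" by (simp add: A_def)
  qed
  then obtain x c where x: "x \<in> \<Delta>" and c: "\<And>j. j < n \<Longrightarrow> (\<Sum>i<n. A x j i) = c" by blast
  define D where "D j = {q x j<..<q x (Suc j)}" for j
  have lohi': "lo \<le> hi" if "h \<in> H" for h
    using lohi[OF that] H[OF that] by linarith
  show thesis
  \<comment> \<open>A member of \<open>H\<close> yields \<open>lo \<le> hi\<close>, on which the
    order of the cuts depends.\<close>
  proof (cases "H = {}")
    case True
    then show thesis using pierce[of "{}"] \<open>0 < n\<close> by simp
  next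
    case False
    then have "lo \<le> hi" using lohi' by blast
    have mono_q: "q x i \<le> q x j" if "i \<le> j" for i j
      unfolding q_def using x that \<open>lo \<le> hi\<close>
      by (intro add_left_mono mult_left_mono sum_mono2) (auto simp: \<Delta>_def)
    have "0 \<le> c" using c[OF \<open>0 < n\<close>] by (auto simp: A_def W_nonneg intro!: sum_nonneg)
    show thesis
    proof (cases "c = 0")
      case False
      show thesis
      proof (rule gaps[of D "A x" c])
        have "D i \<inter> D j = {}" if "i < j" for i j
          using mono_q[of "Suc i" j] that by (auto simp: D_def)
        then show "disjoint_family_on D {..<n}"
          by (auto simp: disjoint_family_on_def) (metis Int_commute disjoint_iff linorder_neqE_nat)
        show "A x i j = A x j i" for i j by (simp add: A_def)
        show "0 \<le> A x i j" for i j by (simp add: A_def W_nonneg)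
        show "0 < c" using False \<open>0 \<le> c\<close> by simp
        have sub: "{l..r} \<subseteq> D j" if "\<psi> l r x j \<noteq> 0" for l r j
          using that by (auto simp: \<psi>_def D_def max_def split: if_splits)
        have W_sub: "\<exists>h\<in>H. {a h..b h} \<subseteq> D i \<and> {a' h..b' h} \<subseteq> D j" if W: "W x i j \<noteq> 0" for i j
        proof -
          obtain h where "h \<in> H" "\<psi> (a h) (b h) x i * \<psi> (a' h) (b' h) x j \<noteq> 0"
            using W unfolding W_def by (rule sum.not_neutral_contains_not_neutral)
          then show ?thesis using sub by (intro bexI[of _ h]) auto
        qed
        show "\<exists>h\<in>H. ({a h..b h} \<subseteq> D i \<and> {a' h..b' h} \<subseteq> D j) \<or>
            ({a h..b h} \<subseteq> D j \<and> {a' h..b' h} \<subseteq> D i)" if "0 < A x i j" for i j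
        proof -
          have "W x i j \<noteq> 0 \<or> W x j i \<noteq> 0" using that by (auto simp: A_def)
          then show ?thesis using W_sub by blast
        qed
      qed (use c in auto)
    next
      case True
      \<comment> \<open>The ends \<open>q x 0 = lo\<close> and \<open>q x n = hi\<close> are left
        out, which leaves at most \<open>n - 1\<close> cuts.\<close>
      define C where "C = q x ` {1..<n}"
      have "card C < n"
        using card_image_le[of "{1..<n}" "q x"] \<open>0 < n\<close> by (simp add: C_def)
      moreover have "C \<inter> h \<noteq> {}" if h: "h \<in> H" for h
      proof
        assume CH: "C \<inter> h = {}"
        have gap: "\<exists>j<n. 0 < \<psi> l r x j" if lr: "lo < l" "r < hi" "C \<inter> {l..r} = {}" "l \<le> r" for l r
        proof -
          \<comment> \<open>The last cut left of \<open>l\<close>. The next cut is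
            \<open>hi\<close>, or it is at least \<open>l\<close> and, missing
            \<open>{l..r}\<close>, exceeds \<open>r\<close>.\<close>
          define j where "j = Max {k. k < n \<and> q x k < l}"
          have q0: "q x 0 < l" using lr by (simp add: q_def)
          have "j \<in> {k. k < n \<and> q x k < l}"
            unfolding j_def using q0 \<open>0 < n\<close> by (intro Max_in) auto
          then have j: "j < n" "q x j < l" by auto
          have "r < q x (Suc j)"
          proof (cases "Suc j < n")
            case True
            have "l \<le> q x (Suc j)"
            proof (rule ccontr)
              assume "\<not> l \<le> q x (Suc j)"
              then have "Suc j \<le> j" unfolding j_def using True by (intro Max_ge) (auto simp: j_def)
              then show False by simp
            qed
            moreover have "q x (Suc j) \<in> C" using True by (auto simp: C_def)
            ultimately show ?thesis using lr(3) by force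
          next
            case False
            then have "Suc j = n" using j by simp
            then show ?thesis using x lr by (simp add: q_def \<Delta>_def)
          qed
          then show ?thesis using j by (auto simp: \<psi>_def)
        qed
        have "C \<inter> {a h..b h} = {}" "C \<inter> {a' h..b' h} = {}" using CH H[OF h] by blast+
        then obtain i j where ij: "i < n" "j < n" "0 < \<psi> (a h) (b h) x i" "0 < \<psi> (a' h) (b' h) x j"
          using gap lohi[OF h] H[OF h] by meson
        \<comment> \<open>An edge missed by all cuts would give row \<open>i\<close> a positive
          sum.\<close>
        have "0 < \<psi> (a h) (b h) x i * \<psi> (a' h) (b' h) x j" using ij by simp
        also have "\<dots> \<le> W x i j"
          unfolding W_def using h \<open>finite H\<close> by (intro member_le_sum) (auto simp: \<psi>_nonneg)
        also have "\<dots> \<le> A x i j" by (simp add: A_def W_nonneg)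
        also have "\<dots> \<le> (\<Sum>j<n. A x i j)"
          using ij by (intro member_le_sum) (auto simp: A_def W_nonneg)
        finally show False using c[OF ij(1)] True by simp
      qed
      ultimately show thesis using pierce[of C] by (simp add: C_def)
    qed
  qed
qed

section \<open>Matchings in weighted graphs with constant degree\<close>

text \<open>In a maximum matching \<open>E\<close> the unmatched vertices \<open>U\<close> span no
  edge, so their total weight \<open>c * card U\<close> goes to matched vertices. Each edge of
  \<open>E\<close> takes at most \<open>c\<close> of it, whence \<open>card U \<le> card E\<close>,
  while \<open>E\<close> covers at most \<open>2 * card E\<close> vertices.\<close>

lemma symmetric_support_matching:
  fixes A :: "'a \<Rightarrow> 'a \<Rightarrow> real"
  assumes fin: "finite V" and sym: "\<And>i j. A i j = A j i" and nonneg: "\<And>i j. 0 \<le> A i j"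
    and row: "\<And>i. i \<in> V \<Longrightarrow> (\<Sum>j\<in>V. A i j) = c" and "0 < c"
  obtains E where "E \<subseteq> {{i, j} |i j. i \<in> V \<and> j \<in> V \<and> 0 < A i j}" "pairwise disjnt E" "card V \<le> 3 * card E"
proof -
  \<comment> \<open>A loop gives a singleton as an edge, so edges have one or two vertices.\<close>
  define X where "X = {{i, j} |i j. i \<in> V \<and> j \<in> V \<and> 0 < A i j}"
  have X_sub: "X \<subseteq> Pow V" by (auto simp: X_def)
  have finX: "finite X" using X_sub fin by (meson finite_Pow_iff finite_subset)
  define good where "good E \<longleftrightarrow> E \<subseteq> X \<and> pairwise disjnt E" for E
  have "\<exists>E. good E \<and> (\<forall>F. good F \<longrightarrow> card F \<le> card E)"
    by (rule ex_has_greatest_nat[of good "{}" card "Suc (card X)"])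
       (auto simp: good_def less_Suc_eq_le intro: card_mono[OF finX])
  then obtain E where E: "E \<subseteq> X" "pairwise disjnt E" and max: "\<And>F. good F \<Longrightarrow> card F \<le> card E"
    by (auto simp: good_def)
  have finE: "finite E" using E(1) finX finite_subset by blast
  define U where "U = V - \<Union>E"
  have finU: "finite U" using fin by (simp add: U_def)
  have edgeX: "e \<subseteq> V" "finite e" "e \<noteq> {}" "card e \<le> 2" if "e \<in> E" for e
    using that E(1) by (auto simp: X_def card_insert_if)
  have card_Union: "card (\<Union>E) \<le> 2 * card E"
  proof -
    have "card (\<Union>E) \<le> (\<Sum>e\<in>E. card e)"
      by (rule card_Union_le_sum_card)
    also have "\<dots> \<le> (\<Sum>e\<in>E. 2)"
      by (intro sum_mono edgeX)
    finally show ?thesis by simp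
  qed
  have UU: "A u u' = 0" if "u \<in> U" "u' \<in> U" for u u'
  proof (rule ccontr)
    assume "A u u' \<noteq> 0"
    then have "0 < A u u'" using nonneg[of u u'] by simp
    then have "{u, u'} \<in> X" using that by (auto simp: X_def U_def)
    moreover have "disjnt {u, u'} e" if "e \<in> E" for e
      using that \<open>u \<in> U\<close> \<open>u' \<in> U\<close> by (auto simp: U_def)
    ultimately have "good (insert {u, u'} E)"
      using E by (auto simp: good_def pairwise_insert disjnt_sym)
    moreover have "{u, u'} \<notin> E" using \<open>u \<in> U\<close> by (auto simp: U_def)
    ultimately show False using max[of "insert {u, u'} E"] finE by simp
  qed
  \<comment> \<open>An edge of the matching joined to two different unmatched vertices at its two ends could be
    replaced by two edges.\<close>
  have absorb: "(\<Sum>v\<in>e. \<Sum>u\<in>U. A u v) \<le> c" if e: "e \<in> E" for e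
  proof -
    have le_c: "(\<Sum>u\<in>U. A u v) \<le> c" if "v \<in> V" for v
    proof -
      have "(\<Sum>u\<in>U. A u v) \<le> (\<Sum>u\<in>V. A u v)"
        using fin nonneg by (intro sum_mono2) (auto simp: U_def)
      also have "\<dots> = c" using row[OF that] sym by simp
      finally show ?thesis .
    qed
    obtain a b where ab: "e = {a, b}" "a \<in> V" "b \<in> V"
      using e E(1) by (auto simp: X_def)
    show ?thesis
    proof (cases "a = b")
      case True
      then show ?thesis using ab le_c by simp
    next
      case False
      then have sum_e: "(\<Sum>v\<in>e. \<Sum>u\<in>U. A u v) = (\<Sum>u\<in>U. A u a) + (\<Sum>u\<in>U. A u b)"
        using ab by simp
      have same: "u = u'" if u: "u \<in> U" "u' \<in> U" "A u a \<noteq> 0" "A u' b \<noteq> 0" for u u'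
      proof (rule ccontr)
        assume ne: "u \<noteq> u'"
        have pos: "0 < A u a" "0 < A u' b" using u(3,4) nonneg by (simp_all add: order_less_le)
        have out: "u \<notin> \<Union>E" "u' \<notin> \<Union>E" "u \<in> V" "u' \<in> V" using u by (auto simp: U_def)
        have ins: "a \<in> \<Union>E" "b \<in> \<Union>E" using e ab by auto
        let ?F = "insert {u, a} (insert {u', b} (E - {e}))"
        have inX: "{u, a} \<in> X" "{u', b} \<in> X" using pos out ab unfolding X_def by blast+
        have dis: "disjnt {u, a} {u', b}"
          using ne False out ins by auto
        have "disjnt {u, a} f" "disjnt {u', b} f" if f: "f \<in> E - {e}" for f
        proof -
          have "disjnt e f" using E(2) e f by (auto simp: pairwise_def)
          then show "disjnt {u, a} f" "disjnt {u', b} f"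
            using ab out f by (auto simp: disjnt_def)
        qed
        then have "good ?F"
          using E inX dis pairwise_subset[OF E(2), of "E - {e}"] unfolding good_def pairwise_insert
          by (simp add: disjnt_sym) blast
        moreover have "{u, a} \<notin> insert {u', b} (E - {e})" "{u', b} \<notin> E - {e}"
          using out dis by auto
        then have "card ?F = Suc (Suc (card (E - {e})))"
          using finE by simp
        moreover have "card E = Suc (card (E - {e}))"
          by (rule card.remove[OF finE e])
        ultimately show False using max[of ?F] by linarith
      qed
      \<comment> \<open>If both ends receive weight from \<open>U\<close>, then by
        \<open>same\<close> it all comes from one vertex \<open>u\<close>, whose row sum is
        \<open>c\<close>. Otherwise at most one end receives weight.\<close>
      consider "\<forall>u\<in>U. A u a = 0" | "\<forall>u\<in>U. A u b = 0"
        | u u' where "u \<in> U" "A u a \<noteq> 0" "u' \<in> U" "A u' b \<noteq> 0" by blast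
      then show ?thesis
      proof cases
        case 1
        then show ?thesis using sum_e le_c[OF ab(3)] by simp
      next
        case 2
        then show ?thesis using sum_e le_c[OF ab(2)] by simp
      next
        case 3
        have "A w a = 0" "A w b = 0" if "w \<in> U - {u}" for w
          using same[of u w] same[of w u'] same[of u u'] 3 that by auto
        then have "(\<Sum>w\<in>U. A w a) = A u a" "(\<Sum>w\<in>U. A w b) = A u b"
          using 3(1) finU by (simp_all add: sum.remove)
        moreover have "A u a + A u b = (\<Sum>v\<in>{a, b}. A u v)" using False by simp
        moreover have "\<dots> \<le> (\<Sum>v\<in>V. A u v)"
          using ab fin nonneg by (intro sum_mono2) auto
        moreover have "\<dots> = c" using row 3(1) by (simp add: U_def)
        ultimately show ?thesis using sum_e by linarith
      qed
    qed
  qed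
  \<comment> \<open>The weight leaving \<open>U\<close> is counted at its sources and at the edges
    of \<open>E\<close>.\<close>
  have "c * real (card U) = (\<Sum>u\<in>U. \<Sum>v\<in>V. A u v)"
    using row by (simp add: U_def)
  also have "\<dots> = (\<Sum>u\<in>U. \<Sum>v\<in>\<Union>E. A u v)"
  proof (rule sum.cong[OF refl])
    fix u assume "u \<in> U"
    then show "(\<Sum>v\<in>V. A u v) = (\<Sum>v\<in>\<Union>E. A u v)"
      using fin edgeX UU by (intro sum.mono_neutral_right) (auto simp: U_def)
  qed
  also have "\<dots> = (\<Sum>v\<in>\<Union>E. \<Sum>u\<in>U. A u v)" by (rule sum.swap)
  also have "\<dots> = (\<Sum>e\<in>E. \<Sum>v\<in>e. \<Sum>u\<in>U. A u v)"
    using edgeX E(2) by (subst sum.Union_disjoint) (auto simp: pairwise_def disjnt_def)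
  also have "\<dots> \<le> (\<Sum>e\<in>E. c)" by (intro sum_mono absorb)
  finally have "c * real (card U) \<le> c * real (card E)" by (simp add: mult.commute)
  then have "card U \<le> card E" using \<open>0 < c\<close> by simp
  moreover have "card V \<le> card (\<Union>E) + card U"
  proof -
    have "card V = card (\<Union>E \<union> U)"
      using edgeX(1) by (intro arg_cong[of _ _ card]) (auto simp: U_def)
    then show ?thesis by (simp add: card_Un_le)
  qed
  ultimately have "card V \<le> 3 * card E" using card_Union by linarith
  then show thesis using that E unfolding X_def by blast
qed

section \<open>Heavy points and fractional covers\<close>

text \<open>In the mean over \<open>h\<close> weighted by \<open>w\<close>, the edges meeting
  \<open>h\<close> weigh at most \<open>2 * real d * L\<close>. Some \<open>h\<close> obeys this
  bound; it enters \<open>M\<close>, the edges meeting it are removed, and the loads of the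
  remaining family do not grow.\<close>

lemma disjoint_subfamily_of_bounded_load:
  fixes H :: "'a set set" and w :: "'a set \<Rightarrow> real"
  assumes "finite H" "\<And>h. h \<in> H \<Longrightarrow> h \<noteq> {}"
    and P: "\<And>h. h \<in> H \<Longrightarrow> finite (P h) \<and> card (P h) \<le> d"
    and meet: "\<And>g h. g \<in> H \<Longrightarrow> h \<in> H \<Longrightarrow> g \<inter> h \<noteq> {} \<Longrightarrow> P g \<inter> h \<noteq> {} \<or> P h \<inter> g \<noteq> {}"
    and w: "\<And>h. h \<in> H \<Longrightarrow> 0 \<le> w h" and "0 \<le> L"
    and load: "\<And>h v. h \<in> H \<Longrightarrow> v \<in> P h \<Longrightarrow> sum w {g\<in>H. v \<in> g} \<le> L"
  shows "\<exists>M\<subseteq>H. pairwise disjnt M \<and> sum w H \<le> 2 * real d * L * real (card M)"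
  using assms
proof (induction H rule: finite_psubset_induct)
  case (psubset H)
  note fin = psubset.hyps
  define N where "N h = {g\<in>H. g \<inter> h \<noteq> {}}" for h
  show ?case
  proof (cases "sum w H = 0")
    case True
    then show ?thesis by (intro exI[of _ "{}"]) auto
  next
    case False
    \<comment> \<open>An edge hit by \<open>P h\<close> contains one of at most \<open>d\<close>
      points, each carrying load at most \<open>L\<close>.\<close>
    have hits: "(\<Sum>g\<in>H. if P h \<inter> g \<noteq> {} then w g else 0) \<le> real d * L" if h: "h \<in> H" for h
    proof -
      have "(if P h \<inter> g \<noteq> {} then w g else 0) \<le> (\<Sum>v\<in>P h. if v \<in> g then w g else 0)" if g: "g \<in> H" for g
      proof (cases "P h \<inter> g = {}")
        case True
        then show ?thesis using psubset.prems(4)[OF g] by (auto intro: sum_nonneg)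
      next
        case False
        then obtain v where v: "v \<in> P h" "v \<in> g" by blast
        have "(if v \<in> g then w g else 0) \<le> (\<Sum>v\<in>P h. if v \<in> g then w g else 0)"
          using v(1) psubset.prems(2)[OF h] psubset.prems(4)[OF g] by (intro member_le_sum) auto
        then show ?thesis using v(2) False by simp
      qed
      then have "(\<Sum>g\<in>H. if P h \<inter> g \<noteq> {} then w g else 0) \<le> (\<Sum>g\<in>H. \<Sum>v\<in>P h. if v \<in> g then w g else 0)"
        by (rule sum_mono)
      also have "\<dots> = (\<Sum>v\<in>P h. sum w {g\<in>H. v \<in> g})"
        using fin by (subst sum.swap) (simp add: sum.inter_filter)
      also have "\<dots> \<le> (\<Sum>v\<in>P h. L)" by (intro sum_mono psubset.prems(6)[OF h])
      also have "\<dots> \<le> real d * L"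
        using psubset.prems(2)[OF h] \<open>0 \<le> L\<close> by (simp add: mult_right_mono)
      finally show ?thesis .
    qed
    have "(\<Sum>h\<in>H. w h * sum w (N h)) = (\<Sum>h\<in>H. \<Sum>g\<in>H. if g \<inter> h \<noteq> {} then w h * w g else 0)"
      using fin by (simp add: N_def sum.inter_filter sum_distrib_left if_distrib cong: if_cong)
    \<comment> \<open>A meeting pair is charged to a side whose points hit the other; exchanging
      \<open>g\<close> and \<open>h\<close> shows that the two charges have equal sums, hence the
      factor 2.\<close>
    also have "\<dots> \<le> (\<Sum>h\<in>H. \<Sum>g\<in>H. w h * (if P h \<inter> g \<noteq> {} then w g else 0) + w g * (if P g \<inter> h \<noteq> {} then w h else 0))"
      using psubset.prems(3,4) by (intro sum_mono) (auto simp: Int_commute)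
    also have "\<dots> = 2 * (\<Sum>h\<in>H. w h * (\<Sum>g\<in>H. if P h \<inter> g \<noteq> {} then w g else 0))"
      using sum.swap[of "\<lambda>h g. w g * (if P g \<inter> h \<noteq> {} then w h else 0)" H H]
      by (simp add: sum.distrib sum_distrib_left)
    also have "\<dots> \<le> 2 * (\<Sum>h\<in>H. w h * (real d * L))"
      using psubset.prems(4) hits by (intro mult_left_mono sum_mono) auto
    finally have avg: "(\<Sum>h\<in>H. w h * sum w (N h)) \<le> (\<Sum>h\<in>H. w h * (2 * real d * L))"
      by (simp add: sum_distrib_left mult_ac)
    have "\<exists>h\<in>H. sum w (N h) \<le> 2 * real d * L"
    proof (rule ccontr)
      assume "\<not> ?thesis"
      then have gt: "2 * real d * L < sum w (N h)" if "h \<in> H" for h using that by force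
      \<comment> \<open>An edge of positive weight makes the averaged inequality strict.\<close>
      obtain h where h: "h \<in> H" "w h \<noteq> 0" using False by (meson sum.neutral)
      have "(\<Sum>h\<in>H. w h * (2 * real d * L)) < (\<Sum>h\<in>H. w h * sum w (N h))"
      proof (rule sum_strict_mono_ex1[OF fin])
        show "\<forall>h\<in>H. w h * (2 * real d * L) \<le> w h * sum w (N h)"
          using gt psubset.prems(4) by (blast intro: mult_left_mono less_imp_le)
        show "\<exists>h\<in>H. w h * (2 * real d * L) < w h * sum w (N h)"
        proof (rule bexI[OF _ h(1)])
          have "0 < w h" using h psubset.prems(4) by (simp add: order_less_le)
          then show "w h * (2 * real d * L) < w h * sum w (N h)"
            using gt[OF h(1)] by (rule mult_strict_left_mono[rotated])
        qed
      qed
      with avg show False by simp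
    qed
    then obtain h where h: "h \<in> H" and Nh: "sum w (N h) \<le> 2 * real d * L" by blast
    \<comment> \<open>Nonemptiness puts \<open>h\<close> into \<open>N h\<close>, so the remaining
      family is strictly smaller.\<close>
    have hN: "h \<in> N h" using h psubset.prems(1) by (auto simp: N_def)
    have "\<exists>M\<subseteq>H - N h. pairwise disjnt M \<and> sum w (H - N h) \<le> 2 * real d * L * real (card M)"
    proof (rule psubset.IH)
      show "H - N h \<subset> H" using h hN by auto
      fix g v assume gv: "g \<in> H - N h" "v \<in> P g"
      have "sum w {g\<in>H - N h. v \<in> g} \<le> sum w {g\<in>H. v \<in> g}"
        using fin psubset.prems(4) by (intro sum_mono2) auto
      also have "\<dots> \<le> L" using gv psubset.prems(6) by blast
      finally show "sum w {g\<in>H - N h. v \<in> g} \<le> L" .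
    qed (use psubset.prems in auto)
    then obtain M where M: "M \<subseteq> H - N h" "pairwise disjnt M"
      and le: "sum w (H - N h) \<le> 2 * real d * L * real (card M)" by blast
    have "sum w H = sum w (H - N h) + sum w (N h)"
      using fin by (intro sum.subset_diff) (auto simp: N_def)
    also have "\<dots> \<le> 2 * real d * L * real (card (insert h M))"
    proof -
      have "h \<notin> M" "finite M" using M(1) hN finite_subset[OF _ fin] by auto
      then show ?thesis using le Nh by (simp add: algebra_simps)
    qed
    finally have "sum w H \<le> 2 * real d * L * real (card (insert h M))" .
    moreover have "pairwise disjnt (insert h M)"
      using M by (auto simp: pairwise_insert N_def disjnt_def)
    ultimately show ?thesis using M(1) h by (intro exI[of _ "insert h M"]) auto
  qed
qed

text \<open>LP duality up to an arbitrarily small loss, by the multiplicative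
  weights method: repeatedly pick a heavy point and shrink the weights of the edges through it
  by a factor \<open>exp (- \<eta>)\<close>.\<close>

lemma point_weights_of_heavy_points:
  fixes H :: "'a set set" and b c :: real
  assumes "finite H" "H \<noteq> {}" "finite P" "0 < b" "b < c"
    and heavy: "\<And>w :: 'a set \<Rightarrow> real. (\<And>h. h \<in> H \<Longrightarrow> 0 \<le> w h) \<Longrightarrow>
      \<exists>v\<in>P. c * sum w H \<le> sum w {h\<in>H. v \<in> h}"
  obtains g where "\<And>v. 0 \<le> g v" "sum g P = 1" "\<And>h. h \<in> H \<Longrightarrow> b \<le> sum g (P \<inter> h)"
proof -
  \<comment> \<open>Then \<open>b * (1 + \<eta>)\<close> is the midpoint of \<open>b\<close> and
    \<open>c\<close>; with \<open>1 - exp (- \<eta>) \<ge> \<eta> / (1 + \<eta>)\<close> this makes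
    \<open>x * c\<close> exceed \<open>b * \<eta>\<close>.\<close>
  define \<eta> where "\<eta> = (c - b) / (2 * b)"
  define x where "x = 1 - exp (- \<eta>)"
  have \<eta>: "0 < \<eta>" using assms by (simp add: \<eta>_def)
  have "b * \<eta> < x * c"
  proof -
    have "\<eta> / (1 + \<eta>) = 1 - 1 / (1 + \<eta>)" using \<eta> by (simp add: field_simps)
    also have "\<dots> \<le> x"
      using exp_ge_add_one_self[of \<eta>] \<eta> by (simp add: x_def exp_minus field_simps)
    finally have "\<eta> / (1 + \<eta>) * c \<le> x * c" using assms by (intro mult_right_mono) auto
    moreover have "b * \<eta> < \<eta> / (1 + \<eta>) * c"
    proof -
      have "b * (1 + \<eta>) < c" using assms by (simp add: \<eta>_def field_simps)
      from mult_strict_left_mono[OF this \<eta>] show ?thesis using \<eta> by (simp add: field_simps)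
    qed
    ultimately show ?thesis by linarith
  qed
  \<comment> \<open>Each round gains \<open>x * c - b * \<eta>\<close>; \<open>T\<close> rounds
    outweigh the logarithm of the initial total weight \<open>card H\<close>.\<close>
  then obtain T :: nat where T: "ln (real (card H)) < real T * (x * c - b * \<eta>)"
    using reals_Archimedean3[of "x * c - b * \<eta>"] by auto
  have x: "0 < x" using \<eta> by (simp add: x_def)
  \<comment> \<open>\<open>m v\<close> counts the rounds in which \<open>v\<close> is picked. Each
    round multiplies the total weight by at most
    \<open>1 - x * c \<le> exp (- x * c)\<close>.\<close>
  have "\<exists>m. (\<forall>v. 0 \<le> m v) \<and> sum m P = real T \<and>
      (\<Sum>h\<in>H. exp (- \<eta> * sum m (P \<inter> h))) \<le> real (card H) * exp (- x * c * real T)" for T :: nat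
  proof (induction T)
    case 0
    show ?case by (intro exI[of _ "\<lambda>_. 0"]) auto
  next
    case (Suc T)
    then obtain m where m: "\<And>v. 0 \<le> m v" "sum m P = real T"
      "(\<Sum>h\<in>H. exp (- \<eta> * sum m (P \<inter> h))) \<le> real (card H) * exp (- x * c * real T)" by blast
    define w where "w h = exp (- \<eta> * sum m (P \<inter> h))" for h
    obtain v where v: "v \<in> P" "c * sum w H \<le> sum w {h\<in>H. v \<in> h}"
      using heavy[of w] by (auto simp: w_def)
    define m' where "m' = (\<lambda>u. m u + (if u = v then 1 else 0))"
    have sum_m': "sum m' Q = sum m Q + (if v \<in> Q then 1 else 0)" if "finite Q" for Q
      using that by (simp add: m'_def sum.distrib)
    have "exp (- \<eta> * sum m' (P \<inter> h)) = w h - x * (if v \<in> h then w h else 0)" for h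
      using v(1) \<open>finite P\<close> by (simp add: sum_m' w_def x_def algebra_simps exp_diff exp_minus divide_inverse)
    then have "(\<Sum>h\<in>H. exp (- \<eta> * sum m' (P \<inter> h))) = sum w H - x * sum w {h\<in>H. v \<in> h}"
      using \<open>finite H\<close> by (simp add: sum_subtractf sum_distrib_left sum.inter_filter)
    also have "\<dots> \<le> sum w H * (1 - x * c)"
      using mult_left_mono[OF v(2), of x] x by (simp add: algebra_simps)
    also have "\<dots> \<le> sum w H * exp (- x * c)"
      using exp_ge_add_one_self[of "- x * c"] by (intro mult_left_mono) (auto simp: w_def sum_nonneg)
    also have "\<dots> \<le> real (card H) * exp (- x * c * real T) * exp (- x * c)"
      using m(3) by (intro mult_right_mono) (auto simp: w_def)
    also have "\<dots> = real (card H) * exp (- x * c * real (Suc T))"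
      by (simp add: exp_add[symmetric] algebra_simps)
    finally show ?case
      using m v(1) \<open>finite P\<close> sum_m'[of P] by (intro exI[of _ m']) (auto simp: m'_def)
  qed
  then obtain m where m: "\<And>v. 0 \<le> m v" "sum m P = real T"
    "(\<Sum>h\<in>H. exp (- \<eta> * sum m (P \<inter> h))) \<le> real (card H) * exp (- x * c * real T)" by blast
  have card: "0 < real (card H)" using assms by (simp add: card_gt_0_iff)
  then have "0 \<le> ln (real (card H))" by simp
  with T have "T \<noteq> 0" by (intro notI) simp
  show thesis
  proof (rule that[of "\<lambda>v. m v / real T"])
    show "0 \<le> m v / real T" for v using m by simp
    show "(\<Sum>v\<in>P. m v / real T) = 1" using m(2) \<open>T \<noteq> 0\<close> by (simp add: sum_divide_distrib[symmetric])
    fix h assume h: "h \<in> H"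
    \<comment> \<open>One term is at most the whole sum; logarithms give
      \<open>\<eta> * sum m (P \<inter> h) \<ge> x * c * T - ln (card H)\<close>, which exceeds
      \<open>b * \<eta> * T\<close> by the choice of \<open>T\<close>.\<close>
    have "exp (- \<eta> * sum m (P \<inter> h)) \<le> (\<Sum>h\<in>H. exp (- \<eta> * sum m (P \<inter> h)))"
      using h \<open>finite H\<close> by (intro member_le_sum) auto
    also have "\<dots> \<le> exp (ln (real (card H)) - x * c * real T)"
      using m(3) card by (simp add: exp_diff exp_minus divide_inverse)
    finally have "\<eta> * (b * real T) \<le> \<eta> * sum m (P \<inter> h)"
      using T by (simp add: algebra_simps)
    then show "b \<le> (\<Sum>v\<in>P \<inter> h. m v / real T)"
      using \<eta> \<open>T \<noteq> 0\<close> by (simp add: sum_divide_distrib[symmetric] field_simps)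
  qed
qed

section \<open>Hypergraphs of intervals\<close>

lemma d_interval_nonempty:
  assumes "d_interval d h"
  shows "h \<noteq> {}"
  using assms unfolding d_interval_def by fastforce

text \<open>The left endpoints of the components serve. Going left from a common point of two
  members, the first such endpoint reached lies in both; this is why the segment
  \<open>{u..x}\<close> is recorded.\<close>

lemma d_interval_left_endpoints:
  assumes "d_interval d h"
  obtains P where "finite P" "card P \<le> d" "P \<subseteq> h" "\<And>x. x \<in> h \<Longrightarrow> \<exists>u\<in>P. u \<le> x \<and> {u..x} \<subseteq> h"
proof -
  obtain k :: nat and a b :: "nat \<Rightarrow> real" where k: "k \<le> d" "\<forall>i<k. a i \<le> b i" "h = (\<Union>i<k. {a i..b i})"
    using assms unfolding d_interval_def by blast
  show thesis
  proof (rule that[of "a ` {..<k}"])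
    show "card (a ` {..<k}) \<le> d" using card_image_le[of "{..<k}" a] k(1) by simp
    show "a ` {..<k} \<subseteq> h" using k by auto
    fix x assume "x \<in> h"
    then obtain i where i: "i < k" "a i \<le> x" "x \<le> b i" using k(3) by auto
    then have "{a i..x} \<subseteq> h" unfolding k(3) by fastforce
    then show "\<exists>u\<in>a ` {..<k}. u \<le> x \<and> {u..x} \<subseteq> h" using i by auto
  qed simp
qed

section \<open>Elementary bounds on matching and cover numbers\<close>

lemma card_le_matching_number:
  assumes "finite H" "matching H M"
  shows "card M \<le> matching_number H"
proof -
  have "{card M |M. matching H M} \<subseteq> card ` Pow H" by (auto simp: matching_def)
  then have "finite {card M |M. matching H M}" using assms(1) finite_surj by blast
  then show ?thesis unfolding matching_number_def using assms(2) by (intro Max_ge) auto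
qed

lemma frac_cover_number_le:
  assumes "fractional_cover H g"
  shows "frac_cover_number H \<le> sum g (supp g)"
  unfolding frac_cover_number_def
proof (rule cInf_lower)
  show "bdd_below {sum g (supp g) |g. fractional_cover H g}"
    by (intro bdd_belowI[of _ 0]) (auto simp: fractional_cover_def intro: sum_nonneg)
qed (use assms in blast)

lemma frac_cover_number_le_card:
  assumes "finite C" "\<And>h. h \<in> H \<Longrightarrow> C \<inter> h \<noteq> {}"
  shows "frac_cover_number H \<le> real (card C)"
proof -
  define g where "g v = (if v \<in> C then 1 else 0 :: real)" for v
  have supp: "supp g = C" by (auto simp: supp_def g_def)
  have "1 \<le> sum g (C \<inter> h)" if "h \<in> H" for h
  proof -
    have "0 < card (C \<inter> h)" using assms that by (simp add: card_gt_0_iff)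
    moreover have "sum g (C \<inter> h) = real (card (C \<inter> h))" by (simp add: g_def)
    ultimately show ?thesis by simp
  qed
  then have "fractional_cover H g" using assms(1) by (auto simp: fractional_cover_def supp) (simp add: g_def)
  from frac_cover_number_le[OF this] show ?thesis by (simp add: supp g_def)
qed

section \<open>The bound for general \<open>d\<close>\<close>

text \<open>The greedy matching, with \<open>L\<close> the largest load, shows that some left
  endpoint carries at least the fraction \<open>1 / K\<close> of any edge weighting. Duality gives
  covers of weight at most \<open>1 / b\<close> for every positive \<open>b < 1 / K\<close>, and
  \<open>b\<close> tends to \<open>1 / K\<close>.\<close>

lemma frac_cover_number_d_intervals:
  assumes "finite H" "\<forall>h\<in>H. d_interval d h"
  shows "frac_cover_number H \<le> 2 * real d * real (matching_number H)"
proof (cases "H = {}")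
  case True
  then show ?thesis using frac_cover_number_le_card[of "{}" H] by simp (smt (verit) mult_nonneg_nonneg of_nat_0_le_iff)
next
  case False
  define K where "K = 2 * real d * real (matching_number H)"
  have "\<forall>h\<in>H. \<exists>P. finite P \<and> card P \<le> d \<and> P \<subseteq> h \<and> (\<forall>x\<in>h. \<exists>u\<in>P. u \<le> x \<and> {u..x} \<subseteq> h)"
    using assms(2) by (meson d_interval_left_endpoints)
  from bchoice[OF this] obtain P where
    P: "\<forall>h\<in>H. finite (P h) \<and> card (P h) \<le> d \<and> P h \<subseteq> h \<and> (\<forall>x\<in>h. \<exists>u\<in>P h. u \<le> x \<and> {u..x} \<subseteq> h)" ..
  define Q where "Q = (\<Union>h\<in>H. P h)"
  have finQ: "finite Q" using P assms(1) by (auto simp: Q_def)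
  have ne: "h \<noteq> {}" if "h \<in> H" for h using assms(2) d_interval_nonempty that by blast
  have "Q \<noteq> {}"
  proof -
    obtain h x where h: "h \<in> H" and "x \<in> h" using False ne by blast
    then obtain u where "u \<in> P h" using P by blast
    then show ?thesis using h unfolding Q_def by blast
  qed
  have meet: "P g \<inter> h \<noteq> {} \<or> P h \<inter> g \<noteq> {}" if gh: "g \<in> H" "h \<in> H" "g \<inter> h \<noteq> {}" for g h
  proof -
    obtain x where x: "x \<in> g" "x \<in> h" using gh(3) by blast
    obtain u where u: "u \<in> P g" "u \<le> x" "{u..x} \<subseteq> g" using P gh(1) x(1) by blast
    obtain v where v: "v \<in> P h" "v \<le> x" "{v..x} \<subseteq> h" using P gh(2) x(2) by blast
    have "u \<in> h \<or> v \<in> g" using u v by (cases "u \<le> v") auto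
    then show ?thesis using u(1) v(1) by blast
  qed
  have heavy: "\<exists>v\<in>Q. sum w H \<le> K * sum w {h\<in>H. v \<in> h}" if w: "\<And>h. h \<in> H \<Longrightarrow> 0 \<le> w h" for w
  proof -
    define L where "L = Max ((\<lambda>v. sum w {h\<in>H. v \<in> h}) ` Q)"
    have "L \<in> (\<lambda>v. sum w {h\<in>H. v \<in> h}) ` Q"
      unfolding L_def using finQ \<open>Q \<noteq> {}\<close> by (intro Max_in) auto
    then obtain v where v: "v \<in> Q" "L = sum w {h\<in>H. v \<in> h}" by blast
    have "0 \<le> L" unfolding v(2) using w by (intro sum_nonneg) auto
    have "\<exists>M\<subseteq>H. pairwise disjnt M \<and> sum w H \<le> 2 * real d * L * real (card M)"
    proof (rule disjoint_subfamily_of_bounded_load[where P = P])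
      show "sum w {g\<in>H. v \<in> g} \<le> L" if "h \<in> H" "v \<in> P h" for h v
        unfolding L_def using that finQ by (intro Max_ge) (auto simp: Q_def)
    qed (use assms(1) ne P meet w \<open>0 \<le> L\<close> in auto)
    then obtain M where M: "M \<subseteq> H" "pairwise disjnt M" "sum w H \<le> 2 * real d * L * real (card M)" by blast
    have "matching H M" using M(1,2) by (auto simp: matching_def pairwise_def disjnt_def)
    then have "real (card M) \<le> real (matching_number H)"
      using card_le_matching_number assms(1) by simp
    then have "2 * real d * L * real (card M) \<le> 2 * real d * L * real (matching_number H)"
      using \<open>0 \<le> L\<close> by (intro mult_left_mono) auto
    then have "sum w H \<le> K * L" using M(3) by (simp add: K_def mult_ac)
    then show ?thesis using v by blast
  qed
  \<comment> \<open>With unit weights, \<open>K = 0\<close> would give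
    \<open>card H \<le> 0\<close>.\<close>
  have "0 < K"
  proof -
    have "0 < real (card H)" using False assms(1) by (simp add: card_gt_0_iff)
    moreover obtain v where "real (card H) \<le> K * sum (\<lambda>_. 1) {h\<in>H. v \<in> h}"
      using heavy[of "\<lambda>_. 1"] by auto
    ultimately have "K \<noteq> 0" by auto
    moreover have "0 \<le> K" by (simp add: K_def)
    ultimately show ?thesis by simp
  qed
  have bound: "frac_cover_number H \<le> 1 / b" if b: "0 < b" "b < 1 / K" for b
  proof -
    obtain g where g: "\<And>v. 0 \<le> g v" "sum g Q = 1" "\<And>h. h \<in> H \<Longrightarrow> b \<le> sum g (Q \<inter> h)"
    proof (rule point_weights_of_heavy_points[OF assms(1) False finQ b])
      fix w :: "real set \<Rightarrow> real" assume "\<And>h. h \<in> H \<Longrightarrow> 0 \<le> w h"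
      from heavy[OF this] show "\<exists>v\<in>Q. 1 / K * sum w H \<le> sum w {h\<in>H. v \<in> h}"
        using \<open>0 < K\<close> by (simp add: divide_le_eq mult.commute)
    qed blast
    \<comment> \<open>The point weights have total 1 and give each edge at least \<open>b\<close>,
      so dividing by \<open>b\<close> makes them a cover.\<close>
    define g' where "g' v = (if v \<in> Q then g v / b else 0)" for v
    have supp: "supp g' \<subseteq> Q" by (auto simp: supp_def g'_def)
    have sum_g': "sum g' (supp g' \<inter> h) = sum g (Q \<inter> h) / b" for h
    proof -
      have "sum g' (supp g' \<inter> h) = sum g' (Q \<inter> h)"
        using finQ supp by (intro sum.mono_neutral_left) (auto simp: supp_def)
      also have "\<dots> = (\<Sum>v\<in>Q \<inter> h. g v / b)" by (intro sum.cong) (auto simp: g'_def)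
      finally show ?thesis by (simp add: sum_divide_distrib)
    qed
    have "fractional_cover H g'"
      unfolding fractional_cover_def
    proof (intro conjI allI ballI)
      show "finite (supp g')" using finite_subset[OF supp finQ] .
      show "0 \<le> g' v" for v using g(1) b by (simp add: g'_def)
      show "1 \<le> sum g' (supp g' \<inter> h)" if "h \<in> H" for h using g(3)[OF that] b by (simp add: sum_g')
    qed
    from frac_cover_number_le[OF this] show ?thesis using sum_g'[of UNIV] g(2) by simp
  qed
  have "frac_cover_number H \<le> K"
  proof (rule field_le_epsilon)
    fix e :: real assume e: "0 < e"
    then have "1 / (K + e) < 1 / K" using \<open>0 < K\<close> by (simp add: frac_less2)
    then show "frac_cover_number H \<le> K + e" using bound[of "1 / (K + e)"] e \<open>0 < K\<close> by simp
  qed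
  then show ?thesis by (simp add: K_def)
qed

section \<open>Covers by cut points for \<open>d \<le> 2\<close>\<close>

text \<open>Disjoint index sets have disjoint unions of regions, so the members chosen inside them
  are disjoint; being nonempty, they are also distinct, and none is lost in counting.\<close>

lemma card_le_matching_number_of_regions:
  assumes "finite H" "pairwise disjnt E" "disjoint_family_on D (\<Union>E)"
    and ex: "\<And>e. e \<in> E \<Longrightarrow> \<exists>h\<in>H. h \<noteq> {} \<and> h \<subseteq> (\<Union>i\<in>e. D i)"
  shows "card E \<le> matching_number H"
proof -
  have "\<forall>e\<in>E. \<exists>h. h \<in> H \<and> h \<noteq> {} \<and> h \<subseteq> (\<Union>i\<in>e. D i)" using ex by blast
  from bchoice[OF this] obtain f where f: "\<forall>e\<in>E. f e \<in> H \<and> f e \<noteq> {} \<and> f e \<subseteq> (\<Union>i\<in>e. D i)" ..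
  have dis: "f e \<inter> f e' = {}" if e: "e \<in> E" "e' \<in> E" "e \<noteq> e'" for e e'
  proof -
    have "e \<inter> e' = {}" using assms(2) e by (auto simp: pairwise_def disjnt_def)
    then have "D i \<inter> D j = {}" if "i \<in> e" "j \<in> e'" for i j
      using disjoint_family_onD[OF assms(3), of i j] that e by blast
    moreover have "f e \<subseteq> (\<Union>i\<in>e. D i)" "f e' \<subseteq> (\<Union>i\<in>e'. D i)" using f e(1,2) by simp_all
    ultimately show ?thesis by blast
  qed
  have "inj_on f E"
  proof (rule inj_onI, rule ccontr)
    fix e e' assume "e \<in> E" "e' \<in> E" "f e = f e'" "e \<noteq> e'"
    then show False using dis[of e e'] f by simp
  qed
  moreover have "matching H (f ` E)" using f dis by (auto simp: matching_def)
  ultimately show ?thesis using card_le_matching_number[OF assms(1)] by (metis card_image)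
qed

lemma frac_cover_number_2_intervals:
  assumes "finite H" "\<forall>h\<in>H. d_interval 2 h"
  shows "frac_cover_number H \<le> 3 * real (matching_number H)"
proof -
  define \<nu> where "\<nu> = matching_number H"
  have "\<exists>t. fst (fst t) \<le> snd (fst t) \<and> fst (snd t) \<le> snd (snd t) \<and>
      h = {fst (fst t)..snd (fst t)} \<union> {fst (snd t)..snd (snd t) :: real}" if h: "h \<in> H" for h
  proof -
    obtain k :: nat and a b :: "nat \<Rightarrow> real" where k: "1 \<le> k" "k \<le> 2" "\<forall>i<k. a i \<le> b i" "h = (\<Union>i<k. {a i..b i})"
      using bspec[OF assms(2) h] unfolding d_interval_def by blast
    \<comment> \<open>For \<open>k = 1\<close> the index \<open>k - 1\<close> is 0 and the only
      component is listed twice.\<close>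
    have "h = {a 0..b 0} \<union> {a (k - 1)..b (k - 1)}"
    proof -
      have "{..<k} = {0, k - 1}" using k(1,2) by auto
      then show ?thesis using k(4) by simp
    qed
    then show ?thesis using k by (intro exI[of _ "((a 0, b 0), (a (k - 1), b (k - 1)))"]) auto
  qed
  then obtain t where t: "\<And>h. h \<in> H \<Longrightarrow> fst (fst (t h)) \<le> snd (fst (t h)) \<and> fst (snd (t h)) \<le> snd (snd (t h)) \<and>
      h = {fst (fst (t h))..snd (fst (t h))} \<union> {fst (snd (t h))..snd (snd (t h)) :: real}"
    by metis
  \<comment> \<open>With this many gaps a piercing set has at most \<open>3 * \<nu>\<close> points,
    while a matching with at least a third as many edges as gaps would have more than
    \<open>\<nu>\<close> edges.\<close>
  have pos: "0 < 3 * \<nu> + 1" by simp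
  show ?thesis
  proof (rule piercing_or_balanced_gaps[OF assms(1) pos t])
    fix C assume pierce: "finite C" "card C < 3 * \<nu> + 1" "\<And>h. h \<in> H \<Longrightarrow> C \<inter> h \<noteq> {}"
    have "real (card C) \<le> 3 * real \<nu>" using pierce(2) by linarith
    moreover have "frac_cover_number H \<le> real (card C)"
      using pierce(1,3) by (rule frac_cover_number_le_card)
    ultimately show ?thesis unfolding \<nu>_def by linarith
  next
    fix D :: "nat \<Rightarrow> real set" and A :: "nat \<Rightarrow> nat \<Rightarrow> real" and c
    assume gaps: "disjoint_family_on D {..<3 * \<nu> + 1}" "\<And>i j. A i j = A j i" "\<And>i j. 0 \<le> A i j"
      "\<And>i. i < 3 * \<nu> + 1 \<Longrightarrow> (\<Sum>j<3 * \<nu> + 1. A i j) = c" "0 < c"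
      "\<And>i j. 0 < A i j \<Longrightarrow> \<exists>h\<in>H. ({fst (fst (t h))..snd (fst (t h))} \<subseteq> D i \<and> {fst (snd (t h))..snd (snd (t h))} \<subseteq> D j) \<or>
        ({fst (fst (t h))..snd (fst (t h))} \<subseteq> D j \<and> {fst (snd (t h))..snd (snd (t h))} \<subseteq> D i)"
    obtain E where E: "E \<subseteq> {{i, j} |i j. i \<in> {..<3 * \<nu> + 1} \<and> j \<in> {..<3 * \<nu> + 1} \<and> 0 < A i j}"
      "pairwise disjnt E" "card {..<3 * \<nu> + 1} \<le> 3 * card E"
      by (rule symmetric_support_matching[of "{..<3 * \<nu> + 1}" A c]) (use gaps in auto)
    have "card E \<le> \<nu>"
      unfolding \<nu>_def
    proof (rule card_le_matching_number_of_regions[OF assms(1) E(2)])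
      show "disjoint_family_on D (\<Union>E)"
        using E(1) by (intro disjoint_family_on_mono[OF _ gaps(1)]) auto
      fix e assume "e \<in> E"
      then obtain i j where ij: "e = {i, j}" "0 < A i j" using E(1) by blast
      obtain h where h: "h \<in> H" "h \<subseteq> D i \<union> D j" using gaps(6)[OF ij(2)] t by blast
      then show "\<exists>h\<in>H. h \<noteq> {} \<and> h \<subseteq> (\<Union>i\<in>e. D i)"
        using assms(2) d_interval_nonempty ij(1) by (intro bexI[of _ h]) auto
    qed
    then show ?thesis using E(3) by simp
  qed
qed

text \<open>Every interval is listed as both of its components, so positive weight in row
  \<open>i\<close> means that gap \<open>i\<close> contains a member. If piercing fails,
  \<open>\<nu> + 1\<close> gaps would give that many disjoint members.\<close>

lemma frac_cover_number_intervals: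
  assumes "finite H" "\<forall>h\<in>H. d_interval 1 h"
  shows "frac_cover_number H \<le> real (matching_number H)"
proof -
  define \<nu> where "\<nu> = matching_number H"
  have "\<exists>t. fst t \<le> snd t \<and> h = {fst t..snd t :: real}" if h: "h \<in> H" for h
  proof -
    obtain k :: nat and a b :: "nat \<Rightarrow> real" where k: "1 \<le> k" "k \<le> 1" "\<forall>i<k. a i \<le> b i" "h = (\<Union>i<k. {a i..b i})"
      using bspec[OF assms(2) h] unfolding d_interval_def by blast
    then have "k = 1" by simp
    then show ?thesis using k by (intro exI[of _ "(a 0, b 0)"]) auto
  qed
  then obtain t where t: "\<And>h. h \<in> H \<Longrightarrow> fst (t h) \<le> snd (t h) \<and> h = {fst (t h)..snd (t h) :: real}"
    by metis
  have t2: "fst (t h) \<le> snd (t h) \<and> fst (t h) \<le> snd (t h) \<and> h = {fst (t h)..snd (t h)} \<union> {fst (t h)..snd (t h)}"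
    if "h \<in> H" for h using t[OF that] by simp
  have pos: "0 < \<nu> + 1" by simp
  show ?thesis
  proof (rule piercing_or_balanced_gaps[OF assms(1) pos t2])
    fix C assume pierce: "finite C" "card C < \<nu> + 1" "\<And>h. h \<in> H \<Longrightarrow> C \<inter> h \<noteq> {}"
    have "real (card C) \<le> real \<nu>" using pierce(2) by linarith
    moreover have "frac_cover_number H \<le> real (card C)"
      using pierce(1,3) by (rule frac_cover_number_le_card)
    ultimately show ?thesis unfolding \<nu>_def by linarith
  next
    fix D :: "nat \<Rightarrow> real set" and A :: "nat \<Rightarrow> nat \<Rightarrow> real" and c
    assume gaps: "disjoint_family_on D {..<\<nu> + 1}" "\<And>i j. A i j = A j i" "\<And>i j. 0 \<le> A i j"
      "\<And>i. i < \<nu> + 1 \<Longrightarrow> (\<Sum>j<\<nu> + 1. A i j) = c" "0 < c"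
      "\<And>i j. 0 < A i j \<Longrightarrow> \<exists>h\<in>H. ({fst (t h)..snd (t h)} \<subseteq> D i \<and> {fst (t h)..snd (t h)} \<subseteq> D j) \<or>
        ({fst (t h)..snd (t h)} \<subseteq> D j \<and> {fst (t h)..snd (t h)} \<subseteq> D i)"
    define E where "E = (\<lambda>i. {i}) ` {..<\<nu> + 1}"
    have "card E \<le> \<nu>"
      unfolding \<nu>_def
    proof (rule card_le_matching_number_of_regions[OF assms(1)])
      show "pairwise disjnt E" by (auto simp: E_def pairwise_def)
      show "disjoint_family_on D (\<Union>E)"
        by (intro disjoint_family_on_mono[OF _ gaps(1)]) (auto simp: E_def)
      fix e assume "e \<in> E"
      then obtain i where i: "e = {i}" "i < \<nu> + 1" by (auto simp: E_def)
      have "(\<Sum>j<\<nu> + 1. A i j) \<noteq> 0" using gaps(4)[OF i(2)] gaps(5) by simp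
      then obtain j where j: "A i j \<noteq> 0" by (meson sum.neutral)
      then have "0 < A i j" using gaps(3)[of i j] by simp
      from gaps(6)[OF this] obtain h where h: "h \<in> H" "{fst (t h)..snd (t h)} \<subseteq> D i" by blast
      have "h \<subseteq> D i" using h(2) conjunct2[OF t[OF h(1)]] by argo
      with h(1) show "\<exists>h\<in>H. h \<noteq> {} \<and> h \<subseteq> (\<Union>i\<in>e. D i)"
        using assms(2) d_interval_nonempty i(1) by (intro bexI[of _ h]) auto
    qed
    moreover have "card E = \<nu> + 1" unfolding E_def by (subst card_image) auto
    ultimately show ?thesis by simp
  qed
qed

theorem theorem7p1:
  fixes d :: nat and H :: "real set set"
  assumes "d \<ge> 1" and "finite H" and "\<forall>h\<in>H. d_interval d h"
  shows "frac_cover_number H \<le> (4 * real d - 6 + 3 / real d) * real (matching_number H)"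
proof -
  \<comment> \<open>The coefficient is 1 for \<open>d = 1\<close> and 7/2 for \<open>d = 2\<close>;
    from \<open>d = 3\<close> on, \<open>4 * d - 6\<close> is already at least
    \<open>2 * d\<close>.\<close>
  consider "d = 1" | "d = 2" | "3 \<le> d" using assms(1) by linarith
  then show ?thesis
  proof cases
    case 1
    then show ?thesis using frac_cover_number_intervals assms by simp
  next
    case 2
    then have "frac_cover_number H \<le> 3 * real (matching_number H)"
      using frac_cover_number_2_intervals assms by simp
    also have "\<dots> \<le> (4 * real d - 6 + 3 / real d) * real (matching_number H)"
      using 2 by (intro mult_right_mono) auto
    finally show ?thesis .
  next
    case 3
    have "frac_cover_number H \<le> 2 * real d * real (matching_number H)"
      using frac_cover_number_d_intervals assms by simp
    also have "\<dots> \<le> (4 * real d - 6 + 3 / real d) * real (matching_number H)"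
    proof (rule mult_right_mono)
      have "0 \<le> 3 / real d" "3 \<le> real d" using 3 by auto
      then show "2 * real d \<le> 4 * real d - 6 + 3 / real d" by linarith
    qed simp
    finally show ?thesis .
  qed
qed

end
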